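(* Suppose that risk is measured by the conditional value-at-risk, $\rho=\mathrm{CVaR}_\alpha$ with $\alpha\in(0,1]$, and that the hypotheses $F_\theta$, $\theta\in\Theta$, are uniformly strongly convex with parameter $\gamma>0$. Let $\ell^{\rm p}_\theta,\ell^{\rm s}_\theta,\ell^{\rm f}_\theta$ be the predictability, suboptimality and first-order losses, and let $(\hat\theta_N^{\rm s},\hat J_N^{\rm s})$ and $(\hat\theta_N^{\rm f},\hat J_N^{\rm f})$ be the distributionally robust solutions and certificates corresponding to the suboptimality and first-order losses, respectively. Then, for a significance level $\beta\in[0,1]$, $$\mathbb P_{\rm in}^N\big[\rho^{\mathbb P_{\rm out}}(\ell^{\rm s}_{\hat\theta_N^{\rm s}})\le\hat J_N^{\rm s}\big]\ge1-\beta\ \implies\ \mathbb P_{\rm in}^N\big[\rho^{\mathbb P_{\rm out}}(\ell^{\rm p}_{\hat\theta_N^{\rm s}})\le\tfrac2\gamma\hat J_N^{\rm s}\big]\ge1-\beta$$ and $$\mathbb P_{\rm in}^N\big[\rho^{\mathbb P_{\rm out}}(\ell^{\rm f}_{\hat\theta_N^{\rm f}})\le\hat J_N^{\rm f}\big]\ge1-\beta\ \implies\ \mathbb P_{\rm in}^N\big[\rho^{\mathbb P_{\rm out}}(\ell^{\rm p}_{\hat\theta_N^{\rm f}})\le\tfrac2\gamma\hat J_N^{\rm f}\big]\ge1-\beta.$$ Moreover $\hat J_N^{\rm s}\le\hat J_N^{\rm f}$, so that minimizing the suboptimality loss results in a weakly stronger predictability guarantee.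
   Context: An agent observes a signal $s\in\mathbb S\subseteq\mathbb R^m$ and chooses a response $x\in\mathbb X(s)\subseteq\mathbb R^n$; $\Xi=\{(s,x):s\in\mathbb S,\ x\in\mathbb X(s)\}$. $\{F_\theta:\theta\in\Theta\}$ is a parametric family of candidate objective functions (hypotheses) $F_\theta:\mathbb R^m\times\mathbb R^n\to\mathbb R$, differentiable in $x$, and $\mathbb X^\star_\theta(s)=\arg\min_{y\in\mathbb X(s)}F_\theta(s,y)$. Uniform strong convexity with parameter $\gamma$ means that, for every $\theta\in\Theta$, $F_\theta(s,x)$ is convex in $x$ and $$F_\theta(s,y)-F_\theta(s,x)\ge\langle\nabla_xF_\theta(s,x),y-x\rangle+\frac\gamma2\|y-x\|_2^2\qquad\forall x,y\in\mathbb X(s),\ \forall s\in\mathbb S.$$ The losses are $\ell^{\rm p}_\theta(s,x)=\min_{y\in\mathbb X^\star_\theta(s)}\|x-y\|_2^2$ (predictability), $\ell^{\rm s}_\theta(s,x)=F_\theta(s,x)-\min_{y\in\mathbb X(s)}F_\theta(s,y)$ (suboptimality), $\ell^{\rm f}_\theta(s,x)=\max_{y\in\mathbb X(s)}\langle\nabla_xF_\theta(s,x),x-y\rangle$ (first-order). For a distribution $\mathbb Q$ of $(s,x)$, $\rho^{\mathbb Q}(\ell_\theta)=\mathrm{CVaR}^{\mathbb Q}_\alpha(\ell_\theta)=\inf_{\tau\in\mathbb R}\ \tau+\frac1\alpha\mathbb E^{\mathbb Q}[\max\{\ell_\theta(s,x)-\tau,0\}]$. $N$ independent training samples $\hat\xi_i=(\hat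 s_i,\hat x_i)$ are drawn from a distribution $\mathbb P_{\rm in}$ on $\mathbb R^{m+n}$ of (possibly noisy) signal-response pairs, with joint law $\mathbb P_{\rm in}^N$; $\mathbb P_{\rm out}$ is the distribution of the noise-free pairs and is supported on $\Xi$. The ambiguity set $\hat{\mathcal P}_N$ is a Wasserstein ball of probability distributions supported on $\Xi$ centered at the empirical distribution $\frac1N\sum_{i=1}^N\delta_{\hat\xi_i}$; the same set is used for both losses. For a loss $\ell_\theta$, the distributionally robust solution and certificate are $\hat\theta_N\in\arg\min_{\theta\in\Theta}\sup_{\mathbb Q\in\hat{\mathcal P}_N}\rho^{\mathbb Q}(\ell_\theta)$ and $\hat J_N=\min_{\theta\in\Theta}\sup_{\mathbb Q\in\hat{\mathcal P}_N}\rho^{\mathbb Q}(\ell_\theta)$.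
   Formalization: The feasible sets X(s) are assumed convex; without this the suboptimality implication fails, e.g. F(x)=x², γ=2, X={-1, 1.1}, data at x=1.1, radius 0. Minimizers are assumed to exist and the two concluding events to be measurable. *)

theory Defs
  imports "HOL-Probability.Probability"
begin

definition grad :: "('a::real_inner \<Rightarrow> real) \<Rightarrow> 'a \<Rightarrow> 'a" where
  "grad f x = (THE D. GDERIV f x :> D)"


text \<open>Agent model: signals \<open>s \<in> S\<close>, feasible responses \<open>X s\<close>, hypotheses \<open>F \<theta> s x\<close>.\<close>

definition signal_response_set :: "'s set \<Rightarrow> ('s \<Rightarrow> 'x set) \<Rightarrow> ('s \<times> 'x) set" where
  "signal_response_set S X = {(s, x). s \<in> S \<and> x \<in> X s}"

definition optimal_responses ::
  "('t \<Rightarrow> 's \<Rightarrow> 'x \<Rightarrow> real) \<Rightarrow> ('s \<Rightarrow> 'x set) \<Rightarrow> 't \<Rightarrow> 's \<Rightarrow> 'x set" where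
  "optimal_responses F X \<theta> s = {y. is_arg_min (F \<theta> s) (\<lambda>y. y \<in> X s) y}"

text \<open>Convexity of \<open>F \<theta> s\<close> is required on the feasible set only, where the growth inequality is
  imposed. Note that \<^const>\<open>convex_on\<close> includes convexity of the set \<open>X s\<close>.\<close>

definition uniformly_strongly_convex ::
  "real \<Rightarrow> 't set \<Rightarrow> 's set \<Rightarrow> ('s \<Rightarrow> 'x set) \<Rightarrow> ('t \<Rightarrow> 's \<Rightarrow> 'x::real_inner \<Rightarrow> real) \<Rightarrow> bool" where
  "uniformly_strongly_convex \<gamma> \<Theta> S X F \<longleftrightarrow>
     (\<forall>\<theta>\<in>\<Theta>. \<forall>s\<in>S. convex_on (X s) (F \<theta> s) \<and>
        (\<forall>x\<in>X s. \<forall>y\<in>X s.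
           F \<theta> s y - F \<theta> s x \<ge> grad (F \<theta> s) x \<bullet> (y - x) + \<gamma> / 2 * (norm (y - x))\<^sup>2))"


text \<open>The losses are extended-real-valued, with minima and maxima written as infima and suprema.
  The two agree when the optima are attained, and a first-order loss whose supremum
  is infinite is then \<open>\<infinity>\<close> instead of an arbitrary real.\<close>

definition predictability_loss ::
  "('t \<Rightarrow> 's \<Rightarrow> 'x::real_inner \<Rightarrow> real) \<Rightarrow> ('s \<Rightarrow> 'x set) \<Rightarrow> 't \<Rightarrow> 's \<times> 'x \<Rightarrow> ereal" where
  "predictability_loss F X \<theta> =
     (\<lambda>(s, x). INF y\<in>optimal_responses F X \<theta> s. ereal ((norm (x - y))\<^sup>2))"

definition suboptimality_loss ::
  "('t \<Rightarrow> 's \<Rightarrow> 'x::real_inner \<Rightarrow> real) \<Rightarrow> ('s \<Rightarrow> 'x set) \<Rightarrow> 't \<Rightarrow> 's \<times> 'x \<Rightarrow> ereal" where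
  "suboptimality_loss F X \<theta> =
     (\<lambda>(s, x). ereal (F \<theta> s x) - (INF y\<in>X s. ereal (F \<theta> s y)))"

definition first_order_loss ::
  "('t \<Rightarrow> 's \<Rightarrow> 'x::real_inner \<Rightarrow> real) \<Rightarrow> ('s \<Rightarrow> 'x set) \<Rightarrow> 't \<Rightarrow> 's \<times> 'x \<Rightarrow> ereal" where
  "first_order_loss F X \<theta> =
     (\<lambda>(s, x). SUP y\<in>X s. ereal (grad (F \<theta> s) x \<bullet> (x - y)))"


text \<open>The integrand is nonnegative, so its expectation is a \<open>nn_integral\<close> and may be infinite.\<close>

definition cvar :: "real \<Rightarrow> 'a measure \<Rightarrow> ('a \<Rightarrow> ereal) \<Rightarrow> ereal" where
  "cvar \<alpha> Q l =
     (INF \<tau>\<in>(UNIV :: real set).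
        ereal \<tau> + ereal (1 / \<alpha>) * enn2ereal (\<integral>\<^sup>+ \<xi>. e2ennreal (max (l \<xi> - ereal \<tau>) 0) \<partial>Q))"


text \<open>\<open>\<nu>\<close> plays the role of an arbitrary norm on the sample space, not necessarily Euclidean.\<close>

definition is_norm :: "('a::real_vector \<Rightarrow> real) \<Rightarrow> bool" where
  "is_norm \<nu> \<longleftrightarrow>
     (\<forall>x. \<nu> x = 0 \<longleftrightarrow> x = 0) \<and>
     (\<forall>x y. \<nu> (x + y) \<le> \<nu> x + \<nu> y) \<and>
     (\<forall>c x. \<nu> (c *\<^sub>R x) = \<bar>c\<bar> * \<nu> x)"

definition couplings :: "'a measure \<Rightarrow> 'a measure \<Rightarrow> ('a \<times> 'a) measure set" where
  "couplings P Q =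
     {\<pi>. prob_space \<pi> \<and> sets \<pi> = sets (P \<Otimes>\<^sub>M Q) \<and> distr \<pi> P fst = P \<and> distr \<pi> Q snd = Q}"

definition wasserstein ::
  "('a::real_vector \<Rightarrow> real) \<Rightarrow> real \<Rightarrow> 'a measure \<Rightarrow> 'a measure \<Rightarrow> ennreal" where
  "wasserstein \<nu> p P Q =
     (let c = (INF \<pi>\<in>couplings P Q. \<integral>\<^sup>+ (\<xi>, \<zeta>). ennreal (\<nu> (\<xi> - \<zeta>) powr p) \<partial>\<pi>)
      in if c = \<top> then \<top> else ennreal (enn2real c powr (1 / p)))"

definition empirical_distribution :: "nat \<Rightarrow> (nat \<Rightarrow> 'a::topological_space) \<Rightarrow> 'a measure" where
  "empirical_distribution N \<omega> = distr (uniform_count_measure {..<N}) borel \<omega>"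

definition wasserstein_ball ::
  "('a::{real_vector, topological_space} \<Rightarrow> real) \<Rightarrow> real \<Rightarrow> real \<Rightarrow> 'a set \<Rightarrow> 'a measure \<Rightarrow>
     'a measure set" where
  "wasserstein_ball \<nu> p \<epsilon> \<Xi> P =
     {Q. prob_space Q \<and> sets Q = sets borel \<and> (AE \<xi> in Q. \<xi> \<in> \<Xi>) \<and>
         wasserstein \<nu> p Q P \<le> ennreal \<epsilon>}"


definition worst_case_cvar :: "real \<Rightarrow> 'a measure set \<Rightarrow> ('a \<Rightarrow> ereal) \<Rightarrow> ereal" where
  "worst_case_cvar \<alpha> \<A> l = (SUP Q\<in>\<A>. cvar \<alpha> Q l)"

definition dro_solutions ::
  "real \<Rightarrow> 'a measure set \<Rightarrow> 't set \<Rightarrow> ('t \<Rightarrow> 'a \<Rightarrow> ereal) \<Rightarrow> 't set" where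
  "dro_solutions \<alpha> \<A> \<Theta> l = {\<theta>. is_arg_min (\<lambda>\<theta>. worst_case_cvar \<alpha> \<A> (l \<theta>)) (\<lambda>\<theta>. \<theta> \<in> \<Theta>) \<theta>}"

definition dro_certificate ::
  "real \<Rightarrow> 'a measure set \<Rightarrow> 't set \<Rightarrow> ('t \<Rightarrow> 'a \<Rightarrow> ereal) \<Rightarrow> ereal" where
  "dro_certificate \<alpha> \<A> \<Theta> l = (INF \<theta>\<in>\<Theta>. worst_case_cvar \<alpha> \<A> (l \<theta>))"


text \<open>Training samples are functions \<open>\<omega>\<close> on the index set \<open>{..<N}\<close>.\<close>

abbreviation sample_law :: "nat \<Rightarrow> 'a measure \<Rightarrow> (nat \<Rightarrow> 'a) measure" where
  "sample_law N P \<equiv> Pi\<^sub>M {..<N} (\<lambda>_. P)"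

text \<open>The Wasserstein ball of order \<open>p\<close> and radius \<open>\<epsilon>\<close> around the empirical distribution.\<close>

abbreviation ambiguity_set ::
  "('a::{real_vector, topological_space} \<Rightarrow> real) \<Rightarrow> real \<Rightarrow> real \<Rightarrow> 'a set \<Rightarrow> nat \<Rightarrow> (nat \<Rightarrow> 'a) \<Rightarrow>
     'a measure set" where
  "ambiguity_set \<nu> p \<epsilon> \<Xi> N \<omega> \<equiv> wasserstein_ball \<nu> p \<epsilon> \<Xi> (empirical_distribution N \<omega>)"

end

(*
  The point is the pointwise chain  gamma/2 * l_p <= l_s <= l_f  on Xi.  CVaR is monotone and
  positively homogeneous, and every measure in the ambiguity set, as well as P_out, is concentrated
  on Xi; hence the chain passes to the risks, to their worst cases and to the certificates.
*)
theory Submission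
  imports Defs
begin

text \<open>Comparing \<open>x\<close> and the minimizer \<open>y\<close> with \<open>z = y + t (x - y)\<close> makes the gradient terms cancel
  and bounds the gap below by \<open>(1 - t) \<gamma>/2 \<parallel>x - y\<parallel>\<^sup>2\<close>; letting \<open>t \<rightarrow> 0\<close> spares the first-order
  optimality condition.\<close>

lemma uniformly_strongly_convex_quadratic_growth:
  fixes F :: "'t \<Rightarrow> 's \<Rightarrow> 'x::real_inner \<Rightarrow> real"
  assumes usc: "uniformly_strongly_convex \<gamma> \<Theta> S X F" and \<theta>: "\<theta> \<in> \<Theta>" and s: "s \<in> S"
    and x: "x \<in> X s" and y: "y \<in> optimal_responses F X \<theta> s"
  shows "\<gamma> / 2 * (norm (x - y))\<^sup>2 \<le> F \<theta> s x - F \<theta> s y"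
proof -
  have yX: "y \<in> X s" and min: "\<And>z. z \<in> X s \<Longrightarrow> F \<theta> s y \<le> F \<theta> s z"
    using y by (auto simp: optimal_responses_def is_arg_min_def not_less)
  have "convex (X s)"
    using usc \<theta> s by (auto simp: uniformly_strongly_convex_def convex_on_def)
  have growth: "F \<theta> s b - F \<theta> s a \<ge> grad (F \<theta> s) a \<bullet> (b - a) + \<gamma> / 2 * (norm (b - a))\<^sup>2"
    if "a \<in> X s" "b \<in> X s" for a b
    using usc \<theta> s that by (auto simp: uniformly_strongly_convex_def)
  let ?d = "\<gamma> / 2 * (norm (x - y))\<^sup>2"
  have bound: "(1 - t) * ?d \<le> F \<theta> s x - F \<theta> s y" if t: "0 < t" "t < 1" for t :: real
  proof -
    \<comment> \<open>The weights \<open>t\<close> and \<open>1 - t\<close> are those of the convex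
      combination \<open>z\<close>, so the linear terms \<open>g\<close> cancel, while t (1 - t)^2 +
      (1 - t) t^2 = t (1 - t) collects the quadratic ones.\<close>
    have cancel: "t * ((1 - t) * g + (1 - t)\<^sup>2 * d) + (1 - t) * (- t * g + t\<^sup>2 * d)
        = t * ((1 - t) * d)" for g d :: real
      by (simp add: power2_eq_square algebra_simps)
    define z where "z = (1 - t) *\<^sub>R y + t *\<^sub>R x"
    define g where "g = grad (F \<theta> s) z \<bullet> (x - y)"
    have zX: "z \<in> X s"
      using \<open>convex (X s)\<close> x yX t by (auto simp: z_def convex_alt)
    have xz: "x - z = (1 - t) *\<^sub>R (x - y)" and yz: "y - z = - (t *\<^sub>R (x - y))"
      by (simp_all add: z_def algebra_simps)
    have "F \<theta> s x - F \<theta> s z \<ge> (1 - t) * g + (1 - t)\<^sup>2 * ?d"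
      using growth[OF zX x] unfolding xz
      by (simp only: g_def inner_scaleR_right norm_scaleR power_mult_distrib
          power2_abs mult.left_commute[of "\<gamma> / 2"])
    then have "t * ((1 - t) * g + (1 - t)\<^sup>2 * ?d) \<le> t * (F \<theta> s x - F \<theta> s z)"
      using t by (intro mult_left_mono) auto
    moreover have "F \<theta> s y - F \<theta> s z \<ge> - t * g + t\<^sup>2 * ?d"
      using growth[OF zX yX] unfolding yz
      by (simp only: g_def inner_scaleR_right norm_scaleR inner_minus_right norm_minus_cancel mult_minus_left power_mult_distrib
          power2_abs mult.left_commute[of "\<gamma> / 2"])
    then have "(1 - t) * (- t * g + t\<^sup>2 * ?d) \<le> (1 - t) * (F \<theta> s y - F \<theta> s z)"
      using t by (intro mult_left_mono) auto
    moreover have "t * ((1 - t) * g + (1 - t)\<^sup>2 * ?d) + (1 - t) * (- t * g + t\<^sup>2 * ?d)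
        = t * ((1 - t) * ?d)"
      by (rule cancel)
    moreover have "t * (F \<theta> s x - F \<theta> s z) + (1 - t) * (F \<theta> s y - F \<theta> s z)
        = t * (F \<theta> s x - F \<theta> s y) + (F \<theta> s y - F \<theta> s z)"
      by (simp add: algebra_simps)
    \<comment> \<open>Adding the two weighted inequalities leaves the extra summand
      \<open>F \<theta> s y - F \<theta> s z\<close>, which is at most 0 because \<open>y\<close>
      minimizes over \<open>X s\<close>.\<close>
    ultimately have "t * ((1 - t) * ?d) \<le> t * (F \<theta> s x - F \<theta> s y)"
      using min[OF zX] by linarith
    then show ?thesis
      using t by simp
  qed
  show ?thesis
  proof (rule tendsto_upperbound)
    show "((\<lambda>t. (1 - t) * ?d) \<longlongrightarrow> ?d) (at_right 0)"
      by (auto intro!: tendsto_eq_intros)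
    show "\<forall>\<^sub>F t in at_right 0. (1 - t) * ?d \<le> F \<theta> s x - F \<theta> s y"
      using bound by (auto simp: eventually_at_right_field intro!: exI[of _ 1])
  qed simp
qed

text \<open>Attainment turns the infimum into a real number, so the extended-real subtraction
  becomes an ordinary one, to which the growth inequalities apply.\<close>

lemma suboptimality_loss_eq:
  assumes "y \<in> optimal_responses F X \<theta> s"
  shows "suboptimality_loss F X \<theta> (s, x) = ereal (F \<theta> s x - F \<theta> s y)"
proof -
  have "(INF z\<in>X s. ereal (F \<theta> s z)) = ereal (F \<theta> s y)"
    using assms by (intro antisym INF_lower INF_greatest)
      (auto simp: optimal_responses_def is_arg_min_def not_less)
  then show ?thesis
    by (simp add: suboptimality_loss_def)
qed

text \<open>Any single minimizer bounds the infimum in the predictability loss from above; quadratic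
  growth at that minimizer, divided by \<gamma>/2, gives the constant.\<close>

lemma predictability_loss_le_suboptimality_loss:
  assumes "uniformly_strongly_convex \<gamma> \<Theta> S X F" "\<gamma> > 0" "\<theta> \<in> \<Theta>"
    and "optimal_responses F X \<theta> s \<noteq> {}" "(s, x) \<in> signal_response_set S X"
  shows "predictability_loss F X \<theta> (s, x) \<le> ereal (2 / \<gamma>) * suboptimality_loss F X \<theta> (s, x)"
proof -
  obtain y where y: "y \<in> optimal_responses F X \<theta> s"
    using assms by blast
  have "predictability_loss F X \<theta> (s, x) \<le> ereal ((norm (x - y))\<^sup>2)"
    unfolding predictability_loss_def using y by (auto intro: INF_lower)
  also have "(norm (x - y))\<^sup>2 \<le> 2 / \<gamma> * (F \<theta> s x - F \<theta> s y)"
    using uniformly_strongly_convex_quadratic_growth[OF assms(1,3) _ _ y, of x] assms(2,5)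
    by (simp add: signal_response_set_def field_simps)
  finally show ?thesis
    by (simp add: suboptimality_loss_eq[OF y])
qed

text \<open>Strong convexity expanded at \<open>x\<close> and evaluated at a minimizer
  \<open>y\<close>: the quadratic term is nonnegative and is dropped, and \<open>y\<close> is one of
  the competitors in the supremum.\<close>

lemma suboptimality_loss_le_first_order_loss:
  assumes "uniformly_strongly_convex \<gamma> \<Theta> S X F" "\<gamma> > 0" "\<theta> \<in> \<Theta>"
    and "optimal_responses F X \<theta> s \<noteq> {}" "(s, x) \<in> signal_response_set S X"
  shows "suboptimality_loss F X \<theta> (s, x) \<le> first_order_loss F X \<theta> (s, x)"
proof -
  obtain y where y: "y \<in> optimal_responses F X \<theta> s"
    using assms by blast
  then have yX: "y \<in> X s"
    by (auto simp: optimal_responses_def is_arg_min_def)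
  have "grad (F \<theta> s) x \<bullet> (y - x) + \<gamma> / 2 * (norm (y - x))\<^sup>2 \<le> F \<theta> s y - F \<theta> s x"
    using assms yX by (auto simp: uniformly_strongly_convex_def signal_response_set_def)
  moreover have "0 \<le> \<gamma> / 2 * (norm (y - x))\<^sup>2"
    using assms by simp
  ultimately have "F \<theta> s x - F \<theta> s y \<le> grad (F \<theta> s) x \<bullet> (x - y)"
    by (simp add: inner_diff_right)
  then have "ereal (F \<theta> s x - F \<theta> s y) \<le> first_order_loss F X \<theta> (s, x)"
    unfolding first_order_loss_def using yX by (auto intro!: SUP_upper2[of y])
  then show ?thesis
    by (simp add: suboptimality_loss_eq[OF y])
qed

text \<open>Losses need not be measurable, so \<open>nn_integral_cmult\<close> does not apply to them.\<close>

lemma nn_integral_cmult_le: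
  fixes c :: real
  assumes "c > 0"
  shows "(\<integral>\<^sup>+ x. ennreal c * f x \<partial>M) \<le> ennreal c * (\<integral>\<^sup>+ x. f x \<partial>M)"
  unfolding nn_integral_def[of M "\<lambda>x. ennreal c * f x"]
proof (rule SUP_least)
  fix g assume "g \<in> {g. simple_function M g \<and> g \<le> (\<lambda>x. ennreal c * f x)}"
  then have g: "simple_function M g" and le: "\<And>x. g x \<le> ennreal c * f x"
    by (auto simp: le_fun_def)
  have inv: "ennreal c * (ennreal (1 / c) * u) = u" "ennreal (1 / c) * (ennreal c * u) = u" for u
    using assms by (simp_all flip: mult.assoc ennreal_mult)
  \<comment> \<open>The constant is pulled out of the simple function \<open>g\<close>, which is
    measurable, instead of \<open>f\<close>. Then \<open>g\<close> scaled by \<open>1 / c\<close>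
    lies below \<open>f\<close>, and monotonicity of the integral holds for arbitrary
    functions.\<close>
  have "integral\<^sup>S M g = (\<integral>\<^sup>+ x. ennreal c * (ennreal (1 / c) * g x) \<partial>M)"
    using g by (simp add: inv nn_integral_eq_simple_integral)
  also have "\<dots> = ennreal c * (\<integral>\<^sup>+ x. ennreal (1 / c) * g x \<partial>M)"
    using g by (intro nn_integral_cmult) (auto dest: borel_measurable_simple_function)
  also have "(\<integral>\<^sup>+ x. ennreal (1 / c) * g x \<partial>M) \<le> (\<integral>\<^sup>+ x. f x \<partial>M)"
    using le by (intro nn_integral_mono) (metis inv(2) mult_left_mono zero_le)
  finally show "integral\<^sup>S M g \<le> ennreal c * (\<integral>\<^sup>+ x. f x \<partial>M)"
    by (auto simp: mult_left_mono)
qed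

text \<open>One half of positive homogeneity: the threshold \<tau> for \<open>l\<close> corresponds
  to \<open>c * \<tau>\<close> for the scaled loss.\<close>

lemma cvar_cmult_le:
  assumes c: "c > 0" and \<alpha>: "\<alpha> > 0"
  shows "cvar \<alpha> Q (\<lambda>\<xi>. ereal c * l \<xi>) \<le> ereal c * cvar \<alpha> Q l"
proof -
  let ?I = "\<lambda>\<tau>. enn2ereal (\<integral>\<^sup>+ \<xi>. e2ennreal (max (l \<xi> - ereal \<tau>) 0) \<partial>Q)"
  have "cvar \<alpha> Q (\<lambda>\<xi>. ereal c * l \<xi>) \<le> ereal c * (ereal \<tau> + ereal (1 / \<alpha>) * ?I \<tau>)" for \<tau>
  proof -
    have "max (ereal c * l \<xi> - ereal (c * \<tau>)) 0 = ereal c * max (l \<xi> - ereal \<tau>) 0" for \<xi>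
      using c by (cases "l \<xi>") (auto simp: max_def algebra_simps)
    then have "e2ennreal (max (ereal c * l \<xi> - ereal (c * \<tau>)) 0)
        = ennreal c * e2ennreal (max (l \<xi> - ereal \<tau>) 0)" for \<xi>
      \<comment> \<open>The identity is checked in \<open>ereal\<close>, where
        \<open>e2ennreal\<close> is undone because both truncated values are nonnegative.\<close>
      using c by (subst enn2ereal_inject[symmetric])
        (simp add: times_ennreal.rep_eq enn2ereal_e2ennreal del: enn2ereal_inject)
    then have "(\<integral>\<^sup>+ \<xi>. e2ennreal (max (ereal c * l \<xi> - ereal (c * \<tau>)) 0) \<partial>Q)
        = (\<integral>\<^sup>+ \<xi>. ennreal c * e2ennreal (max (l \<xi> - ereal \<tau>) 0) \<partial>Q)"
      by simp
    also have "\<dots> \<le> ennreal c * (\<integral>\<^sup>+ \<xi>. e2ennreal (max (l \<xi> - ereal \<tau>) 0) \<partial>Q)"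
      using c by (rule nn_integral_cmult_le)
    finally have int: "enn2ereal (\<integral>\<^sup>+ \<xi>. e2ennreal (max (ereal c * l \<xi> - ereal (c * \<tau>)) 0) \<partial>Q)
        \<le> ereal c * ?I \<tau>"
      using c by (simp add: less_eq_ennreal.rep_eq times_ennreal.rep_eq)
    have "cvar \<alpha> Q (\<lambda>\<xi>. ereal c * l \<xi>) \<le> ereal (c * \<tau>) + ereal (1 / \<alpha>) *
        enn2ereal (\<integral>\<^sup>+ \<xi>. e2ennreal (max (ereal c * l \<xi> - ereal (c * \<tau>)) 0) \<partial>Q)"
      unfolding cvar_def by (rule INF_lower) simp
    also have "\<dots> \<le> ereal (c * \<tau>) + ereal (1 / \<alpha>) * (ereal c * ?I \<tau>)"
      using int \<alpha> by (intro add_left_mono ereal_mult_left_mono) auto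
    \<comment> \<open>The case split covers an infinite expected excess; there both sides are
      infinite since \<open>c\<close> and \<alpha> are positive.\<close>
    also have "\<dots> = ereal c * (ereal \<tau> + ereal (1 / \<alpha>) * ?I \<tau>)"
      using c \<alpha> by (cases "?I \<tau>") (auto simp: algebra_simps)
    finally show ?thesis .
  qed
  \<comment> \<open>Dividing by \<open>c\<close> first leaves a lower bound for each term of the
    infimum over \<tau>, so the constant never has to be moved through that infimum.\<close>
  then have "cvar \<alpha> Q (\<lambda>\<xi>. ereal c * l \<xi>) / ereal c \<le> cvar \<alpha> Q l"
    unfolding cvar_def[of \<alpha> Q l] using c by (intro INF_greatest) (simp add: ereal_divide_le_pos)
  then show ?thesis
    using c by (simp add: ereal_divide_le_pos)
qed

text \<open>Almost-everywhere comparison is the form required, since the losses are ordered only on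
  the support set. The infima are compared at equal \<tau>.\<close>

lemma cvar_mono_AE:
  assumes "AE \<xi> in Q. l \<xi> \<le> l' \<xi>" "\<alpha> > 0"
  shows "cvar \<alpha> Q l \<le> cvar \<alpha> Q l'"
  unfolding cvar_def
proof (rule INF_mono', rule add_left_mono, rule ereal_mult_left_mono)
  fix \<tau> :: real
  have "(\<integral>\<^sup>+ \<xi>. e2ennreal (max (l \<xi> - ereal \<tau>) 0) \<partial>Q) \<le> (\<integral>\<^sup>+ \<xi>. e2ennreal (max (l' \<xi> - ereal \<tau>) 0) \<partial>Q)"
    using assms(1) by (intro nn_integral_mono_AE)
      (auto elim!: eventually_mono intro!: e2ennreal_mono max.mono ereal_minus_mono)
  then show "enn2ereal (\<integral>\<^sup>+ \<xi>. e2ennreal (max (l \<xi> - ereal \<tau>) 0) \<partial>Q)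
      \<le> enn2ereal (\<integral>\<^sup>+ \<xi>. e2ennreal (max (l' \<xi> - ereal \<tau>) 0) \<partial>Q)"
    by (simp add: less_eq_ennreal.rep_eq)
qed (use assms in simp)

text \<open>A non-measurable event has \<open>measure\<close> 0, so it needs no measurability assumption.\<close>

lemma (in finite_measure) measure_mono_measurable:
  assumes "\<And>x. x \<in> space M \<Longrightarrow> P x \<Longrightarrow> R x" "Measurable.pred M R"
  shows "\<P>(x in M. P x) \<le> \<P>(x in M. R x)"
proof (cases "{x \<in> space M. P x} \<in> sets M")
  case True
  then show ?thesis
    using assms by (intro finite_measure_mono) auto
qed (simp add: measure_notin_sets)

theorem mainTheorem5:
  fixes S :: "(real ^ 'm) set"
    and X :: "real ^ 'm \<Rightarrow> (real ^ 'n) set"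
    and \<Theta> :: "'t set"
    and F :: "'t \<Rightarrow> real ^ 'm \<Rightarrow> real ^ 'n \<Rightarrow> real"
    and P_in P_out :: "((real ^ 'm) \<times> (real ^ 'n)) measure"
    and \<nu> :: "(real ^ 'm) \<times> (real ^ 'n) \<Rightarrow> real"
    and \<alpha> \<beta> \<gamma> p \<epsilon> :: real
    and N :: nat
    and \<Xi> :: "((real ^ 'm) \<times> (real ^ 'n)) set"
    and amb :: "(nat \<Rightarrow> (real ^ 'm) \<times> (real ^ 'n)) \<Rightarrow> ((real ^ 'm) \<times> (real ^ 'n)) measure set"
    and l_p l_s l_f :: "'t \<Rightarrow> (real ^ 'm) \<times> (real ^ 'n) \<Rightarrow> ereal"
    and \<theta>_s \<theta>_f :: "(nat \<Rightarrow> (real ^ 'm) \<times> (real ^ 'n)) \<Rightarrow> 't"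
    and J_s J_f :: "(nat \<Rightarrow> (real ^ 'm) \<times> (real ^ 'n)) \<Rightarrow> ereal"
  assumes Xi: "\<Xi> = signal_response_set S X"
    and differentiable: "\<And>\<theta> s x. \<theta> \<in> \<Theta> \<Longrightarrow> F \<theta> s differentiable (at x)"
    and attained: "\<And>\<theta> s. \<theta> \<in> \<Theta> \<Longrightarrow> s \<in> S \<Longrightarrow> optimal_responses F X \<theta> s \<noteq> {}"
    and gamma: "\<gamma> > 0"
    and strongly_convex: "uniformly_strongly_convex \<gamma> \<Theta> S X F"
    and alpha: "0 < \<alpha>" "\<alpha> \<le> 1"
    and beta: "0 \<le> \<beta>" "\<beta> \<le> 1"
    and P_in: "prob_space P_in" "sets P_in = sets borel"
    and P_out: "prob_space P_out" "sets P_out = sets borel" "AE \<xi> in P_out. \<xi> \<in> \<Xi>"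
    and N: "N \<ge> 1"
    and wasserstein_parameters: "is_norm \<nu>" "p \<ge> 1" "\<epsilon> \<ge> 0"
    and amb: "amb = ambiguity_set \<nu> p \<epsilon> \<Xi> N"
    and l_p: "l_p = predictability_loss F X"
    and l_s: "l_s = suboptimality_loss F X"
    and l_f: "l_f = first_order_loss F X"
    and theta_s: "\<And>\<omega>. \<omega> \<in> space (sample_law N P_in) \<Longrightarrow> \<theta>_s \<omega> \<in> dro_solutions \<alpha> (amb \<omega>) \<Theta> l_s"
    and theta_f: "\<And>\<omega>. \<omega> \<in> space (sample_law N P_in) \<Longrightarrow> \<theta>_f \<omega> \<in> dro_solutions \<alpha> (amb \<omega>) \<Theta> l_f"
    and J_s: "J_s = (\<lambda>\<omega>. dro_certificate \<alpha> (amb \<omega>) \<Theta> l_s)"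
    and J_f: "J_f = (\<lambda>\<omega>. dro_certificate \<alpha> (amb \<omega>) \<Theta> l_f)"
    \<comment> \<open>the probabilities in the two conclusions are well-defined\<close>
    and event_s: "Measurable.pred (sample_law N P_in)
                    (\<lambda>\<omega>. cvar \<alpha> P_out (l_p (\<theta>_s \<omega>)) \<le> ereal (2 / \<gamma>) * J_s \<omega>)"
    and event_f: "Measurable.pred (sample_law N P_in)
                    (\<lambda>\<omega>. cvar \<alpha> P_out (l_p (\<theta>_f \<omega>)) \<le> ereal (2 / \<gamma>) * J_f \<omega>)"
  shows "(\<P>(\<omega> in sample_law N P_in. cvar \<alpha> P_out (l_s (\<theta>_s \<omega>)) \<le> J_s \<omega>) \<ge> 1 - \<beta> \<longrightarrow>
          \<P>(\<omega> in sample_law N P_in. cvar \<alpha> P_out (l_p (\<theta>_s \<omega>)) \<le> ereal (2 / \<gamma>) * J_s \<omega>) \<ge> 1 - \<beta>) \<and>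
         (\<P>(\<omega> in sample_law N P_in. cvar \<alpha> P_out (l_f (\<theta>_f \<omega>)) \<le> J_f \<omega>) \<ge> 1 - \<beta> \<longrightarrow>
          \<P>(\<omega> in sample_law N P_in. cvar \<alpha> P_out (l_p (\<theta>_f \<omega>)) \<le> ereal (2 / \<gamma>) * J_f \<omega>) \<ge> 1 - \<beta>) \<and>
         (\<forall>\<omega>\<in>space (sample_law N P_in). J_s \<omega> \<le> J_f \<omega>)"
proof -
  interpret sample: prob_space "sample_law N P_in"
    by (rule prob_space_PiM) (rule P_in)
  have Theta: "\<theta>_s \<omega> \<in> \<Theta>" "\<theta>_f \<omega> \<in> \<Theta>" if "\<omega> \<in> space (sample_law N P_in)" for \<omega>
    using theta_s[OF that] theta_f[OF that] by (auto simp: dro_solutions_def is_arg_min_def)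
  have in_S: "s \<in> S" if "(s, x) \<in> \<Xi>" for s x
    using that by (simp add: Xi signal_response_set_def)
  have p_s: "l_p \<theta> \<xi> \<le> ereal (2 / \<gamma>) * l_s \<theta> \<xi>" and s_f: "l_s \<theta> \<xi> \<le> l_f \<theta> \<xi>"
    if "\<theta> \<in> \<Theta>" "\<xi> \<in> \<Xi>" for \<theta> \<xi>
    using predictability_loss_le_suboptimality_loss[OF strongly_convex gamma that(1) attained]
      suboptimality_loss_le_first_order_loss[OF strongly_convex gamma that(1) attained] that in_S
    by (cases \<xi>; simp add: l_p l_s l_f Xi)+
  \<comment> \<open>The dominating loss \<open>l\<close> and the bound \<open>J\<close> stay
    generic, so that this serves both the suboptimality and the first-order guarantee.\<close>
  have risk: "cvar \<alpha> P_out (l_p \<theta>) \<le> ereal (2 / \<gamma>) * J"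
    if "\<And>\<xi>. \<xi> \<in> \<Xi> \<Longrightarrow> l_p \<theta> \<xi> \<le> ereal (2 / \<gamma>) * l \<xi>" "cvar \<alpha> P_out l \<le> J" for \<theta> l J
  proof -
    have "cvar \<alpha> P_out (l_p \<theta>) \<le> cvar \<alpha> P_out (\<lambda>\<xi>. ereal (2 / \<gamma>) * l \<xi>)"
      using P_out(3) that(1) alpha by (intro cvar_mono_AE) (auto elim!: eventually_mono)
    also have "\<dots> \<le> ereal (2 / \<gamma>) * cvar \<alpha> P_out l"
      using gamma alpha by (intro cvar_cmult_le) simp_all
    also have "\<dots> \<le> ereal (2 / \<gamma>) * J"
      using that(2) gamma by (intro ereal_mult_left_mono) auto
    finally show ?thesis .
  qed
  have p_f: "l_p \<theta> \<xi> \<le> ereal (2 / \<gamma>) * l_f \<theta> \<xi>" if "\<theta> \<in> \<Theta>" "\<xi> \<in> \<Xi>" for \<theta> \<xi>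
    using p_s[OF that] ereal_mult_left_mono[OF s_f[OF that], of "ereal (2 / \<gamma>)"] gamma
    by (auto intro: order_trans)
  \<comment> \<open>For each sample, the first event implies the second by \<open>risk\<close> at
    the hypothesis chosen from that sample; monotonicity of probability then transfers the
    confidence level.\<close>
  have "\<P>(\<omega> in sample_law N P_in. cvar \<alpha> P_out (l_s (\<theta>_s \<omega>)) \<le> J_s \<omega>)
      \<le> \<P>(\<omega> in sample_law N P_in. cvar \<alpha> P_out (l_p (\<theta>_s \<omega>)) \<le> ereal (2 / \<gamma>) * J_s \<omega>)"
    using risk p_s Theta by (intro sample.measure_mono_measurable event_s) blast
  moreover have "\<P>(\<omega> in sample_law N P_in. cvar \<alpha> P_out (l_f (\<theta>_f \<omega>)) \<le> J_f \<omega>)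
      \<le> \<P>(\<omega> in sample_law N P_in. cvar \<alpha> P_out (l_p (\<theta>_f \<omega>)) \<le> ereal (2 / \<gamma>) * J_f \<omega>)"
    using risk p_f Theta by (intro sample.measure_mono_measurable event_f) blast
  moreover have "J_s \<omega> \<le> J_f \<omega>" for \<omega>
    unfolding J_s J_f dro_certificate_def worst_case_cvar_def
  \<comment> \<open>Both certificates range over the same hypotheses and the same ambiguity set, so
    they are compared term by term: equal \<theta> in the infimum, equal \<open>Q\<close> in the
    supremum.\<close>
  proof (rule INF_superset_mono[OF order_refl], rule SUP_subset_mono[OF order_refl])
    fix \<theta> Q assume "\<theta> \<in> \<Theta>" "Q \<in> amb \<omega>"
    have "AE \<xi> in Q. \<xi> \<in> \<Xi>"
      using \<open>Q \<in> amb \<omega>\<close> by (simp add: amb wasserstein_ball_def)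
    then show "cvar \<alpha> Q (l_s \<theta>) \<le> cvar \<alpha> Q (l_f \<theta>)"
      using s_f \<open>\<theta> \<in> \<Theta>\<close> alpha by (intro cvar_mono_AE) (auto elim: eventually_mono)
  qed
  ultimately show ?thesis
    by (auto intro: order_trans)
qed

end
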